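(* Let $F$ be an analytic function on the unit disk $\mathbb{D}$ such that $F(z)=O\big((1-|z|)^{-M}\big)$ for some $M$. Assume $F$ has a nontangential boundary limit $F(\zeta)$ at almost every $\zeta\in\partial\mathbb{D}$ and that $$F(\zeta)=f(\zeta):=\sum_{n=-\infty}^{-1}c(n)\zeta^{n}\quad\text{for a.e. }\zeta\in\partial\mathbb{D},$$ where the coefficients satisfy $c(n)=O\big(e^{-\omega(\log|n|)}\big)$ for $n<0$, with $\omega:\mathbb{R}^+\to\mathbb{R}^+$ such that $\omega(t)/t$ is increasing and $\sum_{n\ge1}\frac1{\omega(n)}<\infty$. Then $F$ and $f$ are identically zero.
   Context: $\mathbb{D}=\{z:|z|<1\}$. *)

theory Defs
  imports "HOL-Analysis.Analysis"
begin

definition stolz_region :: "real \<Rightarrow> complex \<Rightarrow> complex set" where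
  "stolz_region \<alpha> \<zeta> = {z. norm z < 1 \<and> norm (z - \<zeta>) < \<alpha> * (1 - norm z)}"

definition nontangential_limit :: "(complex \<Rightarrow> complex) \<Rightarrow> complex \<Rightarrow> complex \<Rightarrow> bool" where
  "nontangential_limit F \<zeta> L \<longleftrightarrow> (\<forall>\<alpha>>1. (F \<longlongrightarrow> L) (at \<zeta> within stolz_region \<alpha> \<zeta>))"

definition neg_series :: "(int \<Rightarrow> complex) \<Rightarrow> complex \<Rightarrow> complex" where
  "neg_series c \<zeta> = (\<Sum>k. c (- (int k + 1)) * \<zeta> powi (- (int k + 1)))"

end

theory Submission
  imports Defs "HOL-Complex_Analysis.Complex_Analysis" "HOL-Real_Asymp.Real_Asymp"
begin

text \<open>
  Let \<open>A i\<close> be the set of points of the disc within distance \<open>exp (- 2 ^ i)\<close> of the circle at which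
  \<open>|F|\<close> exceeds a fixed constant, and let \<open>g\<close> be holomorphic with \<open>Re g \<le> 1\<close> on the disc and
  \<open>Re g \<le> 0\<close> on \<open>A (i + 1)\<close>. With \<open>f\<^sub>N\<close> the partial sum of \<open>f\<close> of length \<open>N = exp (2 ^ i)\<close>, the function
  \<open>|z ^ N (F - f\<^sub>N)| exp (\<omega> (2 ^ i) / 2 \<cdot> Re g)\<close> is at most \<open>exp (O (2 ^ i))\<close> on the boundary of the
  complement of \<open>A (i + 1)\<close>: on the circle because \<open>|f - f\<^sub>N| \<le> exp (- \<omega> (2 ^ i) / 2)\<close>, inside because of
  the growth of \<open>F\<close>. Evaluated on \<open>A i\<close> this gives \<open>Re g \<le> p i = O (2 ^ i / \<omega> (2 ^ i))\<close>, and \<open>p\<close> is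
  summable by Cauchy condensation.

  Take \<open>Re g = 1 - 4 h\<close>, where \<open>h\<close> is the Poisson integral of the set of boundary points whose Stolz
  region meets \<open>A m\<close>; this is at most 0 on \<open>A m\<close>. Descending from \<open>m\<close> to \<open>j\<close> yields
  \<open>1 - 4 h \<le> (\<Sum>i = j..<m. p i) < 1/2\<close> on \<open>A j\<close> for a large fixed \<open>j\<close>. But \<open>h \<rightarrow> 0\<close> pointwise as
  \<open>m \<rightarrow> \<infinity>\<close>, by the almost everywhere nontangential convergence. So \<open>A j\<close> is empty, \<open>F\<close> is bounded, and a
  bounded analytic function with boundary values of purely negative spectrum vanishes.
\<close>

subsection \<open>Schwarz integrals of indicator functions\<close>

lemma norm_cis_diff_le: "norm (cis a - cis b) \<le> \<bar>a - b\<bar>"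
proof -
  have "cis a - cis b = cis b * (cis (a - b) - 1)"
    by (simp add: algebra_simps cis_mult)
  then have "norm (cis a - cis b) = norm (cis (a - b) - 1)"
    by (simp add: norm_mult)
  also have "\<dots> = 2 * \<bar>sin ((a - b) / 2)\<bar>"
    using dist_exp_i_1[of "a - b"] by (simp add: cis_conv_exp)
  also have "\<dots> \<le> 2 * \<bar>(a - b) / 2\<bar>"
    by (intro mult_left_mono abs_sin_x_le_abs_x) auto
  finally show ?thesis by simp
qed

text \<open>The arc \<open>J\<close> has parameter length 1 - |z| and one end at the argument of z.
  The radial projection of z is at distance 1 - |z| from z and the arc adds less than 1 - |z|, so
  the triangle inequality gives the factor 2.\<close>

lemma measure_shadow_ge:
  assumes z: "norm (z::complex) < 1"
    and X: "X \<in> sets borel" "X \<subseteq> {0..2*pi}"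
    and sub: "{t \<in> {0..2*pi}. norm (z - cis t) < 2 * (1 - norm z)} \<subseteq> X"
  obtains J where "J \<in> sets borel" "J \<subseteq> X" "measure lborel J = 1 - norm z"
    "\<forall>t\<in>J. norm (z - cis t) < 2 * (1 - norm z)"
proof -
  define d where "d = 1 - norm z"
  define \<theta> where "\<theta> = Arg2pi z"
  have d: "0 < d" "d \<le> 1" using z by (auto simp: d_def)
  have \<theta>: "0 \<le> \<theta>" "\<theta> < 2*pi" "z = of_real (norm z) * cis \<theta>"
    unfolding \<theta>_def using Arg2pi[of z] by (auto simp: is_Arg_def cis_conv_exp)
  \<comment> \<open>The arc runs to the side on which it stays inside \<open>{0..2*pi}\<close>; a
    symmetric arc could wrap around at an argument near 0.\<close>
  define J where "J = (if \<theta> \<le> pi then {\<theta><..<\<theta>+d} else {\<theta>-d<..<\<theta>})"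
  have "d < pi" using d pi_gt3 by linarith
  then have J1: "J \<subseteq> {0..2*pi}" using \<theta> d unfolding J_def by auto
  have J2: "norm (z - cis t) < 2 * (1 - norm z)" if "t \<in> J" for t
  proof -
    have "z - cis \<theta> = of_real (norm z - 1) * cis \<theta>"
      using \<theta>(3) by (simp add: algebra_simps)
    then have "norm (z - cis \<theta>) = d"
      using d by (simp add: norm_mult d_def del: of_real_diff)
    moreover have "norm (cis \<theta> - cis t) \<le> \<bar>\<theta> - t\<bar>" by (rule norm_cis_diff_le)
    moreover have "\<bar>\<theta> - t\<bar> < d" using that unfolding J_def by (auto split: if_splits)
    moreover have "norm (z - cis t) \<le> norm (z - cis \<theta>) + norm (cis \<theta> - cis t)"
      using norm_triangle_ineq[of "z - cis \<theta>" "cis \<theta> - cis t"] by simp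
    ultimately have "norm (z - cis t) < d + d" by linarith
    then show ?thesis by (simp add: d_def)
  qed
  show ?thesis
  proof (rule that)
    show "J \<in> sets borel" by (simp add: J_def)
    show "J \<subseteq> X" using J1 J2 sub by blast
    show "measure lborel J = 1 - norm z" using d by (simp add: J_def d_def)
  qed (use J2 in blast)
qed

text \<open>\<open>g\<close> is the integral over \<open>X\<close> of the Schwarz kernel (e^(it) +
  z) / (e^(it) - z), without the factor 1/(2 \<pi>), so \<open>Re g\<close> is an unnormalised
  Poisson integral of the indicator of \<open>X\<close>. The upper bound uses that the Poisson
  kernel is at most 2 / (1 - |z|), the lower bound that it is at least 1 / (4 (1 - |z|)) on an arc
  of length 1 - |z|.\<close>

lemma schwarz_integral_exists:
  assumes X: "X \<in> sets borel" "X \<subseteq> {0..2*pi}"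
  obtains g where "g holomorphic_on ball 0 1"
    "\<And>z. norm z < 1 \<Longrightarrow> 0 \<le> Re (g z)"
    "\<And>z. norm z < 1 \<Longrightarrow> Re (g z) \<le> 2 * measure lborel X / (1 - norm z)"
    "\<And>z. norm z < 1 \<Longrightarrow> {t \<in> {0..2*pi}. norm (z - cis t) < 2 * (1 - norm z)} \<subseteq> X \<Longrightarrow> 1/4 \<le> Re (g z)"
proof -
  define M where "M = restrict_space lborel X"
  have Xs: "X \<in> sets lborel" using X by simp
  have fX: "emeasure lborel X < \<infinity>"
  proof -
    have "emeasure lborel X \<le> emeasure lborel {0..2*pi}"
      by (rule emeasure_mono) (use X in auto)
    also have "\<dots> < \<infinity>" by simp
    finally show ?thesis .
  qed
  have spM: "space M = X" by (simp add: M_def space_restrict_space)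
  have emM: "emeasure M A = emeasure lborel A" if "A \<subseteq> X" for A
    unfolding M_def by (rule emeasure_restrict_space) (use that Xs in auto)
  have meM: "measure M A = measure lborel A" if "A \<subseteq> X" for A
    using emM[OF that] by (simp add: measure_def)
  interpret finite_measure M
    by (rule finite_measureI) (use fX emM[of X] spM in simp)
  have measM: "f \<in> borel_measurable M" if "continuous_on UNIV f" for f :: "real \<Rightarrow> complex"
    unfolding M_def by (rule measurable_restrict_space1)
      (use that borel_measurable_continuous_onI in \<open>simp add: measurable_lborel1\<close>)
  define k where "k z t = (cis t + z) / (cis t - z)" for z t
  have ne: "cis t \<noteq> z" if "norm z < 1" for z t using that by auto
  \<comment> \<open>Terms of the expansion of the kernel as 1 plus twice the sum over n \<ge> 1 of
    (e^(-it) z)^n. Integrating them one by one gives a power series for \<open>g\<close>, hence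
    holomorphy.\<close>
  define f where "f z n t = (if n = 0 then 1 else 2 * (cis (-t) * z) ^ n)" for z n t
  have f_sums: "(\<lambda>n. f z n t) sums k z t" if z: "norm z < 1" for z t
  proof -
    define q where "q = cis (-t) * z"
    have q: "norm q < 1" using z by (simp add: q_def norm_mult)
    then have "(\<lambda>n. 2 * q ^ n) sums (2 * (1 / (1 - q)))"
      by (intro sums_mult geometric_sums)
    from sums_diff[OF this sums_single[of 0 "\<lambda>n. 1"]]
    have "(\<lambda>n. f z n t) sums (2 * (1 / (1 - q)) - 1)"
      by (rule sums_cong[THEN iffD1, rotated]) (auto simp: f_def q_def)
    moreover have "2 * (1 / (1 - q)) - 1 = k z t"
    proof -
      have "1 - q \<noteq> 0" using q by auto
      moreover have "z = cis t * q" by (simp add: q_def mult.assoc[symmetric] cis_mult)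
      ultimately show ?thesis
        using ne[OF z, of t] by (simp add: k_def field_simps)
    qed
    ultimately show ?thesis by simp
  qed
  have f_norm: "norm (f z n t) \<le> 2 * norm z ^ n" for z n t
    by (simp add: f_def norm_mult norm_power)
  have f_int: "integrable M (f z n)" for z n
  proof (rule integrable_const_bound[where B = "2 * norm z ^ n"])
    show "f z n \<in> borel_measurable M"
      by (cases "n = 0") (auto simp: f_def[abs_def] intro!: measM continuous_intros)
  qed (simp add: f_norm)
  define g where "g z = (\<integral>t. k z t \<partial>M)" for z
  define a where "a n = (\<integral>t. f 1 n t \<partial>M)" for n
  have g_sums: "(\<lambda>n. a n * (z - 0) ^ n) sums g z" if z: "z \<in> ball 0 1" for z
  proof -
    have z': "norm z < 1" using z by simp
    have geo: "summable (\<lambda>n. 2 * norm z ^ n)" using z' by (simp add: summable_geometric)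
    have "(\<lambda>n. \<integral>t. f z n t \<partial>M) sums (\<integral>t. (\<Sum>n. f z n t) \<partial>M)"
    proof (rule sums_integral)
      show "AE t in M. summable (\<lambda>n. norm (f z n t))"
        by (rule AE_I2, rule summable_comparison_test'[OF geo]) (simp add: f_norm)
      have "(\<integral>t. norm (f z n t) \<partial>M) \<le> (\<integral>t. 2 * norm z ^ n \<partial>M)" for n
        by (rule integral_mono) (auto simp: f_norm f_int integrable_norm)
      then have le: "(\<integral>t. norm (f z n t) \<partial>M) \<le> measure M (space M) * (2 * norm z ^ n)" for n
        by (simp add: mult_ac)
      show "summable (\<lambda>n. \<integral>t. norm (f z n t) \<partial>M)"
        by (rule summable_comparison_test'[OF summable_mult[OF geo, of "measure M (space M)"]])
           (use le in simp)
    qed (rule f_int)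
    also have "(\<integral>t. (\<Sum>n. f z n t) \<partial>M) = g z"
      unfolding g_def using f_sums[OF z'] by (simp add: sums_iff)
    also have "(\<lambda>n. \<integral>t. f z n t \<partial>M) = (\<lambda>n. a n * (z - 0) ^ n)"
    proof
      fix n
      have "f z n = (\<lambda>t. f 1 n t * z ^ n)" by (auto simp: f_def fun_eq_iff power_mult_distrib)
      then show "(\<integral>t. f z n t \<partial>M) = a n * (z - 0) ^ n" by (simp add: a_def)
    qed
    finally show ?thesis .
  qed
  have k_int: "integrable M (k z)" if z: "norm z < 1" for z
  proof (rule integrable_const_bound[where B = "2 / (1 - norm z)"])
    show "k z \<in> borel_measurable M"
      unfolding k_def by (intro measM continuous_intros) (use ne[OF z] in auto)
    show "AE t in M. norm (k z t) \<le> 2 / (1 - norm z)"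
    proof (rule AE_I2)
      fix t
      have "norm (cis t + z) \<le> 2" using z norm_triangle_ineq[of "cis t" z] by simp
      moreover have "1 - norm z \<le> norm (cis t - z)" using norm_triangle_ineq2[of "cis t" z] by simp
      ultimately show "norm (k z t) \<le> 2 / (1 - norm z)"
        unfolding k_def norm_divide using z by (intro frac_le) auto
    qed
  qed
  have Re_k: "Re (k z t) = (1 - (norm z)\<^sup>2) / (norm (z - cis t))\<^sup>2" for z t
  proof -
    have "Re (k z t) = Re ((cis t + z) * cnj (cis t - z)) / (norm (cis t - z))\<^sup>2"
      unfolding k_def by (simp only: complex_div_cnj[of "cis t + z"] Re_divide_of_real of_real_power[symmetric])
    also have "Re ((cis t + z) * cnj (cis t - z)) = (norm (cis t))\<^sup>2 - (norm z)\<^sup>2"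
      by (simp only: cmod_power2) (simp add: algebra_simps power2_eq_square)
    finally show ?thesis by (simp add: norm_minus_commute)
  qed
  have Re_g: "Re (g z) = (\<integral>t. Re (k z t) \<partial>M)" if "norm z < 1" for z
    unfolding g_def using k_int[OF that] by simp
  have Re_k_nonneg: "0 \<le> Re (k z t)" if z: "norm z < 1" for z t
    unfolding Re_k using z by (intro divide_nonneg_nonneg) (auto simp: power_le_one)
  show ?thesis
  proof (rule that)
    show "g holomorphic_on ball 0 1" by (rule power_series_holomorphic[OF g_sums])
    show "0 \<le> Re (g z)" if z: "norm z < 1" for z
      unfolding Re_g[OF z] by (rule integral_nonneg_AE) (use Re_k_nonneg[OF z] in auto)
    show "Re (g z) \<le> 2 * measure lborel X / (1 - norm z)" if z: "norm z < 1" for z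
    proof -
      have "Re (k z t) \<le> 2 / (1 - norm z)" for t
      proof -
        have 1: "1 - norm z \<le> norm (z - cis t)" using norm_triangle_ineq2[of "cis t" z] by (simp add: norm_minus_commute)
        have "Re (k z t) \<le> (1 - (norm z)\<^sup>2) / (1 - norm z)\<^sup>2"
          unfolding Re_k using z 1 by (intro divide_left_mono power_mono mult_pos_pos) (auto simp: power_le_one)
        also have "\<dots> = (1 + norm z) / (1 - norm z)"
        proof -
          have "1 - (norm z)\<^sup>2 = (1 - norm z) * (1 + norm z)" by (simp add: algebra_simps power2_eq_square)
          then show ?thesis using z by (simp add: power2_eq_square)
        qed
        also have "\<dots> \<le> 2 / (1 - norm z)" using z by (intro divide_right_mono) auto
        finally show ?thesis .
      qed
      then have "Re (g z) \<le> (\<integral>t. 2 / (1 - norm z) \<partial>M)"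
        unfolding Re_g[OF z] by (intro integral_mono) (auto intro: integrable_Re k_int z)
      also have "\<dots> = 2 * measure lborel X / (1 - norm z)"
        by (simp add: spM meM)
      finally show ?thesis .
    qed
    show "1/4 \<le> Re (g z)" if z: "norm z < 1"
      and sub: "{t \<in> {0..2*pi}. norm (z - cis t) < 2 * (1 - norm z)} \<subseteq> X" for z
    proof -
      obtain J where J: "J \<in> sets borel" "J \<subseteq> X" "measure lborel J = 1 - norm z"
        "\<forall>t\<in>J. norm (z - cis t) < 2 * (1 - norm z)"
        using measure_shadow_ge[OF z X sub] .
      define d where "d = 1 - norm z"
      have d: "d > 0" using z by (simp add: d_def)
      have JM: "J \<in> sets M" unfolding M_def using J X by (auto simp: sets_restrict_space_iff)
      \<comment> \<open>On \<open>J\<close> the denominator |z - e^(it)|^2 is below 4 d^2, while 1 -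
        |z|^2 = d (1 + |z|) \<ge> d. The length d of \<open>J\<close> then cancels the remaining
        1/d.\<close>
      have ge: "1 / (4 * d) * indicator J t \<le> Re (k z t)" for t
      proof (cases "t \<in> J")
        case True
        have p: "0 < norm (z - cis t)" using ne[OF z, of t] by auto
        have "1 / (4 * d) \<le> (1 - (norm z)\<^sup>2) / (2 * d)\<^sup>2"
        proof -
          have "1 - (norm z)\<^sup>2 = d * (1 + norm z)" by (simp add: d_def algebra_simps power2_eq_square)
          then have "(1 - (norm z)\<^sup>2) / (2 * d)\<^sup>2 = (1 + norm z) / (4 * d)"
            using d by (simp add: power2_eq_square)
          then show ?thesis using d by (simp add: divide_right_mono)
        qed
        also have "\<dots> \<le> Re (k z t)"
          unfolding Re_k using z p bspec[OF J(4) True] d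
          by (intro divide_left_mono power_mono mult_pos_pos) (auto simp: power_le_one d_def)
        finally show ?thesis using True by simp
      qed (use Re_k_nonneg[OF z] in simp)
      have "1/4 = (\<integral>t. 1 / (4 * d) * indicator J t \<partial>M)"
        using d J JM by (simp add: meM d_def[symmetric] Int_absorb2 spM)
      also have "\<dots> \<le> Re (g z)"
        unfolding Re_g[OF z] using JM
        by (intro integral_mono ge integrable_Re k_int z) (auto simp: integrable_indicator_iff less_top[symmetric])
      finally show ?thesis .
    qed
  qed
qed

text \<open>Dominated convergence for the indicators of \<open>X n\<close>, with the indicator of
  the interval as majorant.\<close>

lemma measure_tendsto_0_of_AE_eventually_notin:
  fixes X :: "nat \<Rightarrow> real set"
  assumes X: "\<And>n. X n \<in> sets borel" "\<And>n. X n \<subseteq> {a..b}"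
    and ev: "AE t in lborel. eventually (\<lambda>n. t \<notin> X n) sequentially"
  shows "(\<lambda>n. measure lborel (X n)) \<longlonglongrightarrow> 0"
proof -
  have "(\<lambda>n. \<integral>t. indicator (X n) t \<partial>lborel) \<longlonglongrightarrow> integral\<^sup>L lborel (\<lambda>t::real. 0::real)"
  proof (rule integral_dominated_convergence[where w = "indicat_real {a..b}" and M = lborel
        and s = "\<lambda>n. indicat_real (X n)" and f = "\<lambda>_. 0 :: real"])
    show "AE t in lborel. (\<lambda>n. indicator (X n) t :: real) \<longlonglongrightarrow> 0"
      using ev
    proof eventually_elim
      case (elim t)
      show ?case by (rule tendsto_eventually) (use elim in eventually_elim, auto)
    qed
    show "AE t in lborel. norm (indicator (X n) t :: real) \<le> indicator {a..b} t" for n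
      using X(2)[of n] by (auto intro!: AE_I2 split: split_indicator)
    show "integrable lborel (indicat_real {a..b})"
      by (simp add: integrable_indicator_iff emeasure_lborel_Icc_eq)
  qed (use X(1) in auto)
  then show ?thesis using X(1) by simp
qed


subsection \<open>A maximum principle with radial boundary bounds\<close>

text \<open>The set where the radial bound fails on the circle of radius \<open>r\<close> has small measure for
  \<open>r\<close> near 1; its Schwarz integral damps \<open>\<Phi>\<close> there and is negligible at a fixed interior point.\<close>

lemma maximum_principle_AE_radial:
  fixes \<Phi> :: "complex \<Rightarrow> complex"
  assumes holo: "\<Phi> holomorphic_on ball 0 1"
    and \<Omega>: "open \<Omega>" "\<Omega> \<subseteq> ball 0 1"
    and bound: "\<And>z. z \<in> \<Omega> \<Longrightarrow> norm (\<Phi> z) \<le> B"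
    and front: "\<And>z. z \<in> frontier \<Omega> \<Longrightarrow> norm z < 1 \<Longrightarrow> norm (\<Phi> z) \<le> 1"
    and radial: "AE t in lborel. eventually (\<lambda>r. norm (\<Phi> (of_real r * cis t)) \<le> 1) (at_left 1)"
    and z: "z \<in> \<Omega>"
  shows "norm (\<Phi> z) \<le> 1"
proof -
  \<comment> \<open>With this \<open>q\<close>, the factor exp (- q * Re g) absorbs the bound
    \<open>B\<close> wherever \<open>Re g\<close> is at least 1/4; \<open>max B 1\<close> keeps
    \<open>q\<close> nonnegative.\<close>
  define q where "q = 4 * \<bar>ln (max B 1)\<bar>"
  have q: "0 \<le> q" "B * exp (- q / 4) \<le> 1"
  proof -
    show "0 \<le> q" by (simp add: q_def)
    have "exp (- q / 4) = 1 / max B 1" by (simp add: q_def exp_minus inverse_eq_divide)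
    moreover have "B / max B 1 \<le> 1" by (simp add: divide_le_eq_1 max_def)
    ultimately show "B * exp (- q / 4) \<le> 1" by simp
  qed
  have z1: "norm z < 1" using z \<Omega> by auto
  define \<rho>z where "\<rho>z = (1 + norm z) / 2"
  have \<rho>z: "norm z < \<rho>z" "\<rho>z < 1" "0 < \<rho>z" using z1 by (auto simp: \<rho>z_def intro: add_pos_nonneg)
  define r where "r n = 1 - 1 / (real n + 2)" for n
  have r: "0 < r n" "r n < 1" for n by (auto simp: r_def field_simps)
  have r_lim: "r \<longlonglongrightarrow> 1" unfolding r_def by real_asymp
  have r_left: "filterlim r (at_left 1) sequentially"
    unfolding filterlim_at using r r_lim by (auto intro!: always_eventually simp: less_imp_neq)
  define X where "X n = {t \<in> {0..2*pi}. 1 < norm (\<Phi> (of_real (r n) * cis t))}" for n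
  have in_ball: "norm (of_real (r n) * cis t) < 1" for n t
    using r[of n] by (simp add: norm_mult)
  have cont\<Phi>: "continuous_on (ball 0 1) \<Phi>" using holo by (rule holomorphic_on_imp_continuous_on)
  have Xb: "X n \<in> sets borel" for n
  proof -
    have "continuous_on UNIV (\<lambda>t. norm (\<Phi> (of_real (r n) * cis t)))"
      by (intro continuous_intros continuous_on_compose2[OF cont\<Phi>]) (use in_ball in auto)
    then have "(\<lambda>t. norm (\<Phi> (of_real (r n) * cis t))) \<in> borel_measurable borel"
      by (rule borel_measurable_continuous_onI)
    then show ?thesis unfolding X_def by measurable
  qed
  have X2: "X n \<subseteq> {0..2*pi}" for n by (auto simp: X_def)
  have X_lim: "(\<lambda>n. measure lborel (X n)) \<longlonglongrightarrow> 0"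
  proof (rule measure_tendsto_0_of_AE_eventually_notin[OF Xb X2])
    show "AE t in lborel. \<forall>\<^sub>F n in sequentially. t \<notin> X n"
      using radial
    proof eventually_elim
      case (elim t)
      from eventually_compose_filterlim[OF elim r_left] show ?case
        by eventually_elim (auto simp: X_def)
    qed
  qed
  have main: "norm (\<Phi> z) \<le> (1 + \<epsilon>) * exp (q * (2 * measure lborel (X n) / (1 - \<rho>z)))"
    if \<epsilon>: "\<epsilon> > 0" and n: "norm z < r n" "norm z \<le> r n * \<rho>z" for \<epsilon> n
  proof -
    obtain g where g: "g holomorphic_on ball 0 1"
      "\<And>z. norm z < 1 \<Longrightarrow> 0 \<le> Re (g z)"
      "\<And>z. norm z < 1 \<Longrightarrow> Re (g z) \<le> 2 * measure lborel (X n) / (1 - norm z)"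
      "\<And>z. norm z < 1 \<Longrightarrow> {t \<in> {0..2*pi}. norm (z - cis t) < 2 * (1 - norm z)} \<subseteq> X n \<Longrightarrow> 1/4 \<le> Re (g z)"
      using schwarz_integral_exists[OF Xb[of n] X2[of n]] by blast
    have "uniformly_continuous_on (cball 0 (r n)) \<Phi>"
      by (rule compact_uniformly_continuous[OF continuous_on_subset[OF cont\<Phi>]]) (use r[of n] in auto)
    then obtain d where d: "d > 0"
      "\<And>x y. x \<in> cball 0 (r n) \<Longrightarrow> y \<in> cball 0 (r n) \<Longrightarrow> dist y x < d \<Longrightarrow> dist (\<Phi> y) (\<Phi> x) < \<epsilon>"
      using \<epsilon> unfolding uniformly_continuous_on_def by metis
    \<comment> \<open>\<open>g\<close> is evaluated at \<open>m w\<close>, a rescaling that takes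
      the circle of radius \<open>r n\<close> to that of radius \<open>\<rho>\<close> inside the
      disc. The shadow of \<open>m w\<close> has radius 2 (1 - \<rho>) and the rescaling moves
      points by at most 1 - \<rho> more, hence the requirement 3 (1 - \<rho>) \<le> d.\<close>
    define \<rho> where "\<rho> = 1 - min (1/2) (d / 3)"
    have \<rho>: "0 < \<rho>" "\<rho> < 1" "3 * (1 - \<rho>) \<le> d" using d by (auto simp: \<rho>_def min_def)
    define m where "m w = of_real (\<rho> / r n) * w" for w :: complex
    have m: "norm (m w) = \<rho> * (norm w / r n)" for w
      using \<rho> r[of n] by (simp add: m_def norm_mult norm_divide)
    have m1: "norm (m w) \<le> \<rho>" if "norm w \<le> r n" for w
      unfolding m using \<rho> r[of n] that by (intro mult_left_le) auto
    define \<Xi> where "\<Xi> w = \<Phi> w * exp (- of_real q * g (m w))" for w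
    define W where "W = \<Omega> \<inter> ball 0 (r n)"
    have W: "open W" "W \<subseteq> ball 0 (r n)" unfolding W_def using \<Omega> by auto
    have clW: "closure W \<subseteq> cball 0 (r n)" using W(2) by (metis closure_mono closure_ball r(1) less_irrefl)
    have holE: "\<Xi> holomorphic_on cball 0 (r n)"
    proof -
      have gm: "(\<lambda>w. g (m w)) holomorphic_on cball 0 (r n)"
        by (rule holomorphic_on_compose_gen[OF _ g(1), unfolded o_def])
           (use m1 \<rho> in \<open>fastforce simp: m_def[abs_def] intro!: holomorphic_intros\<close>)+
      show ?thesis unfolding \<Xi>_def
        by (intro holomorphic_intros gm holomorphic_on_subset[OF holo]) (use r[of n] in auto)
    qed
    have normE: "norm (\<Xi> w) = norm (\<Phi> w) * exp (- q * Re (g (m w)))" for w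
      by (simp add: \<Xi>_def norm_mult)
    have "norm (\<Xi> z) \<le> 1 + \<epsilon>"
    proof (rule maximum_modulus_frontier[where S = W and f = \<Xi>])
      show "\<Xi> holomorphic_on interior W"
        using holE by (rule holomorphic_on_subset) (use W interior_subset in fastforce)
      show "continuous_on (closure W) \<Xi>"
        using holomorphic_on_imp_continuous_on[OF holE] clW by (rule continuous_on_subset)
      show "bounded W" using W(2) bounded_ball bounded_subset by blast
      show "z \<in> W" using z n by (simp add: W_def)
      fix w assume w: "w \<in> frontier W"
      then have wr: "norm w \<le> r n" using clW by (auto simp: frontier_def)
      have w1: "norm w < 1" using wr r[of n] by simp
      have mw: "norm (m w) < 1" using m1[OF wr] \<rho> by simp
      have le1: "exp (- q * Re (g (m w))) \<le> 1" using q g(2)[OF mw] by simp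
      have small: "norm (\<Xi> w) \<le> 1 + \<epsilon>" if "norm (\<Phi> w) \<le> 1 + \<epsilon>"
        unfolding normE using mult_mono[OF that le1] \<epsilon> by simp
      show "norm (\<Xi> w) \<le> 1 + \<epsilon>"
      \<comment> \<open>A frontier point of \<open>W\<close> outside \<open>\<Omega>\<close> is a
        frontier point of \<open>\<Omega>\<close>; one inside \<open>\<Omega>\<close> must lie on
        the circle of radius \<open>r n\<close>.\<close>
      proof (cases "w \<in> \<Omega>")
        case False
        have "w \<in> closure \<Omega>" using w closure_mono[of W \<Omega>] by (auto simp: frontier_def W_def)
        then have "w \<in> frontier \<Omega>" using False \<Omega> by (simp add: frontier_def interior_open)
        then show ?thesis using front[of w] w1 \<epsilon> small by simp
      next
        case True
        have "w \<notin> W" using w W(1) by (simp add: frontier_def interior_open)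
        then have wn: "norm w = r n" using True wr by (simp add: W_def)
        show ?thesis
        proof (cases "norm (\<Phi> w) \<le> 1 + \<epsilon>")
          case bad: False
          have nmw: "norm (m w) = \<rho>" unfolding m wn using r[of n] by simp
          \<comment> \<open>Where |\<Phi>| exceeds 1 + \<epsilon>, uniform continuity keeps it above
            1 at all points of the circle of radius \<open>r n\<close> within \<open>d\<close>. So
            the whole shadow lies in \<open>X n\<close>, and the damping is at full
            strength.\<close>
          have "{t \<in> {0..2*pi}. norm (m w - cis t) < 2 * (1 - norm (m w))} \<subseteq> X n"
          proof clarify
            fix t assume t: "t \<in> {0..2*pi}" "norm (m w - cis t) < 2 * (1 - norm (m w))"
            define u where "u = of_real (r n) * cis t"
            have "w - u = of_real (r n) * ((m w - cis t) + of_real (1 / r n - \<rho> / r n) * w)"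
              using r[of n] by (simp add: u_def m_def field_simps)
            then have "norm (w - u) \<le> 1 * norm ((m w - cis t) + of_real (1 / r n - \<rho> / r n) * w)"
              using r[of n] by (simp only: norm_mult norm_of_real) (intro mult_right_mono, auto)
            also have "\<dots> \<le> norm (m w - cis t) + norm (of_real (1 / r n - \<rho> / r n) * w)"
              by (simp only: mult_1_left norm_triangle_ineq)
            also have "norm (of_real (1 / r n - \<rho> / r n) * w) = 1 - \<rho>"
              using r[of n] \<rho> by (simp add: norm_mult wn diff_divide_distrib[symmetric] del: of_real_diff of_real_divide)
            finally have "norm (w - u) < d" using t(2) \<rho> nmw by simp
            moreover have "u \<in> cball 0 (r n)" using r[of n] by (simp add: u_def norm_mult)
            ultimately have "norm (\<Phi> w - \<Phi> u) < \<epsilon>"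
              using d(2)[of u w] wr by (simp add: dist_norm)
            then have "1 < norm (\<Phi> u)"
              using bad norm_triangle_ineq2[of "\<Phi> w" "\<Phi> u"] by linarith
            then show "t \<in> X n" using t(1) by (simp add: X_def u_def)
          qed
          from g(4)[OF mw this] have "exp (- q * Re (g (m w))) \<le> exp (- q / 4)"
            using q mult_left_mono[of "1/4" "Re (g (m w))" q] by simp
          then have "norm (\<Xi> w) \<le> B * exp (- q / 4)"
            unfolding normE using bound[OF True] by (intro mult_mono) (auto intro: order_trans[OF norm_ge_zero])
          also have "\<dots> \<le> 1 + \<epsilon>" using q \<epsilon> by simp
          finally show ?thesis .
        qed (rule small)
      qed
    qed
    then have "norm (\<Phi> z) * exp (- q * Re (g (m z))) * exp (q * Re (g (m z))) \<le> (1 + \<epsilon>) * exp (q * Re (g (m z)))"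
      unfolding normE by (intro mult_right_mono) auto
    then have le: "norm (\<Phi> z) \<le> (1 + \<epsilon>) * exp (q * Re (g (m z)))"
      by (simp add: mult.assoc exp_add[symmetric])
    have mz: "norm (m z) \<le> \<rho>z"
    proof -
      have "norm z / r n \<le> \<rho>z" using n(2) r[of n] by (simp add: field_simps)
      then have "norm (m z) \<le> 1 * \<rho>z" unfolding m using \<rho> r[of n] by (intro mult_mono) auto
      then show ?thesis by simp
    qed
    have "Re (g (m z)) \<le> 2 * measure lborel (X n) / (1 - norm (m z))" by (rule g(3)) (use mz \<rho>z in simp)
    also have "\<dots> \<le> 2 * measure lborel (X n) / (1 - \<rho>z)"
      using mz \<rho>z by (intro divide_left_mono mult_pos_pos) auto
    finally have "(1 + \<epsilon>) * exp (q * Re (g (m z))) \<le> (1 + \<epsilon>) * exp (q * (2 * measure lborel (X n) / (1 - \<rho>z)))"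
      using \<epsilon> q by (intro mult_left_mono iffD2[OF exp_le_cancel_iff]) auto
    then show ?thesis using le by (rule order_trans[rotated])
  qed
  \<comment> \<open>First n tends to infinity, so that the measure of \<open>X n\<close> and with it
    the exponent vanish at the fixed point z; then \<epsilon> tends to 0.\<close>
  show ?thesis
  proof (rule field_le_epsilon)
    fix \<epsilon> :: real assume \<epsilon>: "\<epsilon> > 0"
    have "(\<lambda>n. (1 + \<epsilon>) * exp (q * (2 * measure lborel (X n) / (1 - \<rho>z)))) \<longlonglongrightarrow> (1 + \<epsilon>) * exp (q * (2 * 0 / (1 - \<rho>z)))"
      by (intro tendsto_intros X_lim) (use \<rho>z in auto)
    moreover have "eventually (\<lambda>n. norm (\<Phi> z) \<le> (1 + \<epsilon>) * exp (q * (2 * measure lborel (X n) / (1 - \<rho>z)))) sequentially"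
    proof -
      have e1: "eventually (\<lambda>n. norm z < r n) sequentially"
        using order_tendstoD(1)[OF r_lim z1] .
      have "norm z / \<rho>z < 1" using \<rho>z by simp
      from order_tendstoD(1)[OF r_lim this]
      show ?thesis using e1
        by eventually_elim (rule main[OF \<epsilon>], use \<rho>z in \<open>auto simp: field_simps\<close>)
    qed
    ultimately have "norm (\<Phi> z) \<le> (1 + \<epsilon>) * exp (q * (2 * 0 / (1 - \<rho>z)))"
      by (intro tendsto_lowerbound) auto
    then show "norm (\<Phi> z) \<le> 1 + \<epsilon>" by simp
  qed
qed

subsection \<open>Comparison with the partial sums\<close>

lemma nontangential_limit_imp_radial:
  assumes "nontangential_limit F (cis t) L"
  shows "((\<lambda>r. F (of_real r * cis t)) \<longlongrightarrow> L) (at_left 1)"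
proof -
  have "(F \<longlongrightarrow> L) (at (cis t) within stolz_region 2 (cis t))"
    using assms by (simp add: nontangential_limit_def)
  moreover have "filterlim (\<lambda>r. of_real r * cis t) (at (cis t) within stolz_region 2 (cis t)) (at_left 1)"
    unfolding filterlim_at
  proof
    have "((\<lambda>r. complex_of_real r * cis t) \<longlongrightarrow> of_real 1 * cis t) (at_left 1)"
      by (intro tendsto_intros)
    then show "((\<lambda>r. complex_of_real r * cis t) \<longlongrightarrow> cis t) (at_left 1)" by simp
    have "eventually (\<lambda>r. r \<in> {0<..<1::real}) (at_left 1)"
      by (rule eventually_at_leftI[of 0]) auto
    then show "\<forall>\<^sub>F r in at_left 1. complex_of_real r * cis t \<in> stolz_region 2 (cis t) \<and> complex_of_real r * cis t \<noteq> cis t"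
    proof eventually_elim
      case (elim r)
      have "of_real r * cis t - cis t = of_real (r - 1) * cis t" by (simp add: algebra_simps)
      then have "norm (of_real r * cis t - cis t) = 1 - r"
        using elim by (simp add: norm_mult del: of_real_diff)
      then show ?case using elim by (auto simp: stolz_region_def norm_mult)
    qed
  qed
  ultimately show ?thesis by (rule filterlim_compose)
qed

text \<open>The difference of \<open>F\<close> and the \<open>N\<close>-th partial sum of \<open>f\<close>, multiplied by \<open>z ^ N\<close> to remove the
  pole at 0; \<open>d k\<close> is the coefficient of \<open>z ^ -(k + 1)\<close>.\<close>

definition cleared :: "(complex \<Rightarrow> complex) \<Rightarrow> (nat \<Rightarrow> complex) \<Rightarrow> nat \<Rightarrow> complex \<Rightarrow> complex" where
  "cleared F d N z = z ^ N * F z - (\<Sum>k<N. d k * z ^ (N - 1 - k))"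

lemma holomorphic_on_cleared:
  "F holomorphic_on S \<Longrightarrow> cleared F d N holomorphic_on S"
  unfolding cleared_def by (intro holomorphic_intros)

lemma norm_cleared_sum_le:
  fixes d :: "nat \<Rightarrow> complex"
  assumes "summable (\<lambda>k. norm (d k))" "norm z \<le> 1"
  shows "norm (\<Sum>k<N. d k * z ^ (N - 1 - k)) \<le> (\<Sum>k. norm (d k))"
proof -
  have "norm (\<Sum>k<N. d k * z ^ (N - 1 - k)) \<le> (\<Sum>k<N. norm (d k))"
    by (rule sum_norm_le) (use assms(2) in \<open>simp add: norm_mult norm_power mult_left_le power_le_one\<close>)
  also have "\<dots> \<le> (\<Sum>k. norm (d k))" by (rule sum_le_suminf) (use assms(1) in auto)
  finally show ?thesis .
qed

lemma norm_cleared_le: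
  assumes "summable (\<lambda>k. norm (d k))" "norm z \<le> 1"
  shows "norm (cleared F d N z) \<le> norm (F z) + (\<Sum>k. norm (d k))"
proof -
  have "norm (z ^ N * F z) \<le> norm (F z)"
    using assms(2) by (simp add: norm_mult norm_power mult_left_le_one_le power_le_one)
  then show ?thesis
    using norm_cleared_sum_le[OF assms, of N] norm_triangle_ineq4[of "z ^ N * F z" "\<Sum>k<N. d k * z ^ (N - 1 - k)"]
    unfolding cleared_def by linarith
qed

text \<open>On the circle the polynomial in \<open>cleared\<close> is exactly
  \<open>\<zeta> ^ N\<close> times the first \<open>N\<close> terms of the series, so a unimodular
  multiple of the tail remains. For N = 0 this bounds the series itself.\<close>

lemma norm_cleared_boundary_le:
  fixes d :: "nat \<Rightarrow> complex"
  assumes d: "summable (\<lambda>k. norm (d k))" and \<zeta>: "norm \<zeta> = 1"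
  shows "norm (cleared (\<lambda>z. \<Sum>k. d k * z powi (- (int k + 1))) d N \<zeta>) \<le> (\<Sum>k. norm (d (k + N)))"
proof -
  define a where "a k = d k * \<zeta> powi (- (int k + 1))" for k
  have \<zeta>0: "\<zeta> \<noteq> 0" using \<zeta> by auto
  have p: "\<zeta> powi (- (int k + 1)) = inverse (\<zeta> ^ Suc k)" for k
  proof -
    have "- (int k + 1) = - int (Suc k)" by simp
    then show ?thesis by (simp only: power_int_minus power_int_of_nat)
  qed
  have na: "norm (a k) = norm (d k)" for k
    unfolding a_def p using \<zeta> by (simp add: norm_mult norm_inverse norm_power)
  have sa: "summable a" by (rule summable_norm_cancel) (simp add: na d)
  have "\<zeta> ^ N * suminf a = \<zeta> ^ N * (\<Sum>k. a (k + N)) + (\<Sum>k<N. \<zeta> ^ N * a k)"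
    using suminf_split_initial_segment[OF sa, of N] by (simp add: algebra_simps sum_distrib_left)
  also have "(\<Sum>k<N. \<zeta> ^ N * a k) = (\<Sum>k<N. d k * \<zeta> ^ (N - 1 - k))"
  proof (rule sum.cong)
    fix k assume "k \<in> {..<N}"
    then have "N = (N - 1 - k) + Suc k" by auto
    then have "\<zeta> ^ N = \<zeta> ^ (N - 1 - k) * \<zeta> ^ Suc k" by (metis power_add)
    then show "\<zeta> ^ N * a k = d k * \<zeta> ^ (N - 1 - k)" using \<zeta>0 unfolding a_def p by (simp add: field_simps)
  qed simp
  finally have "cleared (\<lambda>z. \<Sum>k. d k * z powi (- (int k + 1))) d N \<zeta> = \<zeta> ^ N * (\<Sum>k. a (k + N))"
    by (simp add: cleared_def a_def)
  then have "norm (cleared (\<lambda>z. \<Sum>k. d k * z powi (- (int k + 1))) d N \<zeta>) = norm (\<Sum>k. a (k + N))"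
    using \<zeta> by (simp add: norm_mult norm_power)
  also have "\<dots> \<le> (\<Sum>k. norm (a (k + N)))"
    by (rule summable_norm) (use d in \<open>simp add: na summable_iff_shift[of "\<lambda>k. norm (d k)"]\<close>)
  finally show ?thesis by (simp add: na)
qed

text \<open>The strict bound holds for the radial limit and therefore at all radii close enough to
  1.\<close>

lemma AE_radial_cleared_le:
  assumes d: "summable (\<lambda>k. norm (d k))"
    and lim: "AE t in lborel. nontangential_limit F (cis t) (\<Sum>k. d k * cis t powi (- (int k + 1)))"
    and \<tau>: "(\<Sum>k. norm (d (k + N))) < \<tau>"
  shows "AE t in lborel. eventually (\<lambda>r. norm (cleared F d N (of_real r * cis t)) \<le> \<tau>) (at_left 1)"
  using lim
proof eventually_elim
  case (elim t)
  define f where "f z = (\<Sum>k. d k * z powi (- (int k + 1)))" for z :: complex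
  have F: "((\<lambda>r. F (of_real r * cis t)) \<longlongrightarrow> f (cis t)) (at_left 1)"
    using nontangential_limit_imp_radial[OF elim] by (simp add: f_def)
  have "((\<lambda>r. norm (cleared F d N (of_real r * cis t))) \<longlongrightarrow>
      norm ((of_real 1 * cis t) ^ N * f (cis t) - (\<Sum>k<N. d k * (of_real 1 * cis t) ^ (N - 1 - k)))) (at_left 1)"
    unfolding cleared_def by (intro tendsto_intros F)
  then have "((\<lambda>r. norm (cleared F d N (of_real r * cis t))) \<longlongrightarrow> norm (cleared f d N (cis t))) (at_left 1)"
    by (simp add: cleared_def)
  moreover have "norm (cleared f d N (cis t)) < \<tau>"
    using norm_cleared_boundary_le[OF d, of "cis t" N] \<tau> unfolding f_def by simp
  ultimately have "\<forall>\<^sub>F r in at_left 1. norm (cleared F d N (of_real r * cis t)) < \<tau>"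
    by (rule order_tendstoD(2))
  then show ?case by eventually_elim simp
qed

text \<open>A two-constants estimate: the maximum principle is applied to
  \<open>cleared F d N\<close> times exp (\<kappa> g) / E off \<open>A\<close>. On the circle the
  tail bound exp (- \<kappa>) offsets the exponential, which is at most exp \<kappa>; on the
  frontier inside the disc, which lies in \<open>A\<close>, the exponential is at most 1.\<close>

lemma norm_cleared_exp_le:
  fixes F g :: "complex \<Rightarrow> complex"
  assumes holo: "F holomorphic_on ball 0 1"
    and d: "summable (\<lambda>k. norm (d k))"
    and lim: "AE t in lborel. nontangential_limit F (cis t) (\<Sum>k. d k * cis t powi (- (int k + 1)))"
    and A: "A \<subseteq> ball 0 1" "open (ball 0 1 - A)"
    and E: "2 \<le> E" "\<And>z. z \<in> ball 0 1 - A \<Longrightarrow> norm (F z) + (\<Sum>k. norm (d k)) \<le> E"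
    and tail: "0 \<le> \<kappa>" "(\<Sum>k. norm (d (k + N))) \<le> exp (- \<kappa>)"
    and g: "g holomorphic_on ball 0 1" "\<And>z. norm z < 1 \<Longrightarrow> Re (g z) \<le> 1" "\<And>z. z \<in> A \<Longrightarrow> Re (g z) \<le> 0"
    and z: "z \<in> ball 0 1 - A"
  shows "norm (cleared F d N z) * exp (\<kappa> * Re (g z)) \<le> E"
proof -
  define \<phi> where "\<phi> = cleared F d N"
  have h\<phi>: "\<phi> holomorphic_on ball 0 1" unfolding \<phi>_def by (rule holomorphic_on_cleared[OF holo])
  define \<Phi> where "\<Phi> w = \<phi> w * exp (of_real \<kappa> * g w) / of_real E" for w
  have n\<Phi>: "norm (\<Phi> w) = norm (\<phi> w) * exp (\<kappa> * Re (g w)) / E" for w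
    using E(1) by (simp add: \<Phi>_def norm_mult norm_divide)
  have \<phi>E: "norm (\<phi> w) \<le> E" if "w \<in> ball 0 1 - A" for w
    using norm_cleared_le[OF d, of w F N] E(2)[OF that] that by (simp add: \<phi>_def)
  have "norm (\<Phi> z) \<le> 1"
  proof (rule maximum_principle_AE_radial[where \<Phi> = \<Phi> and \<Omega> = "ball 0 1 - A" and B = "exp \<kappa>"])
    show "\<Phi> holomorphic_on ball 0 1"
      unfolding \<Phi>_def using E(1) by (intro holomorphic_intros h\<phi> g(1)) auto
    show "norm (\<Phi> w) \<le> exp \<kappa>" if w: "w \<in> ball 0 1 - A" for w
    proof -
      have "\<kappa> * Re (g w) \<le> \<kappa>" using g(2)[of w] w tail(1) by (intro mult_left_le) auto
      then have "norm (\<phi> w) * exp (\<kappa> * Re (g w)) \<le> E * exp \<kappa>"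
        using \<phi>E[OF w] E(1) by (intro mult_mono) auto
      then show ?thesis unfolding n\<Phi> using E(1) by (simp add: field_simps)
    qed
    show "norm (\<Phi> w) \<le> 1" if w: "w \<in> frontier (ball 0 1 - A)" "norm w < 1" for w
    proof -
      have wA: "w \<in> A" using w A(2) by (auto simp: frontier_def interior_open)
      \<comment> \<open>The bound by \<open>E\<close> is known only off \<open>A\<close>; it passes
        to the frontier by continuity.\<close>
      have "norm (\<phi> w) \<le> E"
      proof (rule ccontr)
        assume c: "\<not> norm (\<phi> w) \<le> E"
        define V where "V = ball 0 1 \<inter> (\<lambda>x. norm (\<phi> x)) -` {E<..}"
        have "open V" unfolding V_def
          by (rule continuous_open_preimage)
             (auto intro!: continuous_intros holomorphic_on_imp_continuous_on h\<phi>)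
        moreover have "w \<in> V" using c w by (simp add: V_def)
        moreover have "w \<in> closure (ball 0 1 - A)" using w by (simp add: frontier_def)
        ultimately have "V \<inter> (ball 0 1 - A) \<noteq> {}"
          using open_Int_closure_eq_empty[of V "ball 0 1 - A"] by blast
        then show False using \<phi>E unfolding V_def by fastforce
      qed
      moreover have "exp (\<kappa> * Re (g w)) \<le> 1" using g(3)[OF wA] tail(1) by (simp add: mult_nonneg_nonpos)
      ultimately have "norm (\<phi> w) * exp (\<kappa> * Re (g w)) \<le> E * 1"
        using E(1) by (intro mult_mono) auto
      then show ?thesis unfolding n\<Phi> using E(1) by (simp add: field_simps)
    qed
    \<comment> \<open>The lower bound 2 for \<open>E\<close> turns the tail estimate into the strict
      inequality required for passing from the radial limit to nearby radii.\<close>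
    have "(\<Sum>k. norm (d (k + N))) < E * exp (- \<kappa>)"
    proof -
      have "1 * exp (- \<kappa>) < E * exp (- \<kappa>)" using E(1) by (intro mult_strict_right_mono) auto
      then show ?thesis using tail(2) by linarith
    qed
    from AE_radial_cleared_le[OF d lim this]
    show "AE t in lborel. \<forall>\<^sub>F r in at_left 1. norm (\<Phi> (of_real r * cis t)) \<le> 1"
    proof eventually_elim
      case (elim t)
      have "eventually (\<lambda>r. r \<in> {0<..<1::real}) (at_left 1)"
        by (rule eventually_at_leftI[of 0]) auto
      with elim show ?case
      proof eventually_elim
        case (elim r)
        have "Re (g (of_real r * cis t)) \<le> 1" using elim by (intro g(2)) (simp add: norm_mult)
        then have "\<kappa> * Re (g (of_real r * cis t)) \<le> \<kappa>" using tail(1) by (intro mult_left_le) auto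
        then have "norm (\<phi> (of_real r * cis t)) * exp (\<kappa> * Re (g (of_real r * cis t))) \<le> (E * exp (- \<kappa>)) * exp \<kappa>"
          using elim E(1) unfolding \<phi>_def by (intro mult_mono) auto
        then show ?case unfolding n\<Phi> using E(1) by (simp add: field_simps exp_minus)
      qed
    qed
  qed (use A z in auto)
  then show ?thesis unfolding n\<Phi> \<phi>_def using E(1) by (simp add: field_simps)
qed

subsection \<open>The bounded case\<close>

text \<open>For bounded \<open>F\<close> the maximum principle bounds \<open>cleared F d N\<close>
  on the whole disc by any number above the N-th tail. Its Taylor coefficients of order below N are
  the numbers - d k, so Cauchy's inequality and N tending to infinity give d = 0.\<close>

lemma bounded_imp_zero:
  fixes F :: "complex \<Rightarrow> complex"
  assumes holo: "F holomorphic_on ball 0 1"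
    and bdd: "\<And>z. norm z < 1 \<Longrightarrow> norm (F z) \<le> B"
    and d: "summable (\<lambda>k. norm (d k))"
    and lim: "AE t in lborel. nontangential_limit F (cis t) (\<Sum>k. d k * cis t powi (- (int k + 1)))"
  shows "d = (\<lambda>_. 0)" "\<And>z. norm z < 1 \<Longrightarrow> F z = 0"
proof -
  have le: "norm (cleared F d N z) \<le> \<tau>"
    if z: "norm z < 1" and \<tau>: "(\<Sum>k. norm (d (k + N))) < \<tau>" for N \<tau> z
  proof -
    have \<tau>0: "0 < \<tau>"
      using \<tau> suminf_nonneg[of "\<lambda>k. norm (d (k + N))"] d by (simp add: summable_iff_shift[of "\<lambda>k. norm (d k)"])
    have "norm (cleared F d N z / of_real \<tau>) \<le> 1"
    proof (rule maximum_principle_AE_radial[where \<Phi> = "\<lambda>z. cleared F d N z / of_real \<tau>" and \<Omega> = "ball 0 1"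
          and B = "(B + (\<Sum>k. norm (d k))) / \<tau>"])
      show "(\<lambda>z. cleared F d N z / of_real \<tau>) holomorphic_on ball 0 1"
        using \<tau>0 by (intro holomorphic_intros holomorphic_on_cleared holo) auto
      show "norm (cleared F d N w / of_real \<tau>) \<le> (B + (\<Sum>k. norm (d k))) / \<tau>" if "w \<in> ball 0 1" for w
      proof -
        have "norm (cleared F d N w) \<le> B + (\<Sum>k. norm (d k))"
          using norm_cleared_le[OF d, of w F N] bdd[of w] that by simp
        then show ?thesis using \<tau>0 by (simp add: norm_divide divide_right_mono)
      qed
      show "AE t in lborel. \<forall>\<^sub>F r in at_left 1. norm (cleared F d N (of_real r * cis t) / of_real \<tau>) \<le> 1"
        using AE_radial_cleared_le[OF d lim \<tau>] \<tau>0 by (simp add: norm_divide)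
    qed (use z in auto)
    then show ?thesis using \<tau>0 by (simp add: norm_divide)
  qed
  have d0: "d k = 0" for k
  proof -
    have coeff: "norm (d k) \<le> \<tau>" if N: "k < N" and \<tau>: "(\<Sum>k. norm (d (k + N))) < \<tau>" for N \<tau>
    proof -
      \<comment> \<open>z^N F contributes only to orders from N on, so at order N - 1 - k the
        coefficient is - d k alone.\<close>
      define n where "n = N - 1 - k"
      have "F analytic_on {0}" using holo unfolding analytic_at by (intro exI[of _ "ball 0 1"]) simp
      then have "F has_fps_expansion fps_expansion F 0" by (rule analytic_at_imp_has_fps_expansion_0)
      then have "cleared F d N has_fps_expansion
          fps_X ^ N * fps_expansion F 0 - (\<Sum>l<N. fps_const (d l) * fps_X ^ (N - 1 - l))"
        unfolding cleared_def by (intro fps_expansion_intros)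
      from fps_nth_fps_expansion[OF this, of n]
      have "(deriv ^^ n) (cleared F d N) 0 / fact n = - (\<Sum>l<N. d l * (if n = N - 1 - l then 1 else 0))"
        using N by (simp add: fps_X_power_mult_nth fps_sum_nth n_def)
      also have "(\<Sum>l<N. d l * (if n = N - 1 - l then 1 else 0)) = (\<Sum>l<N. if l = k then d l else 0)"
        using N by (intro sum.cong) (auto simp: n_def)
      finally have "(deriv ^^ n) (cleared F d N) 0 / fact n = - d k" using N by simp
      from arg_cong[OF this, of norm]
      have dk: "norm (d k) = norm ((deriv ^^ n) (cleared F d N) 0) / fact n"
        by (simp add: norm_divide)
      have "norm (d k) * r ^ n \<le> \<tau>" if r: "0 < r" "r < 1" for r
      proof -
        have "norm ((deriv ^^ n) (cleared F d N) 0) \<le> fact n * \<tau> / r ^ n"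
        proof (rule Cauchy_inequality[OF _ _ r(1)])
          have hol: "cleared F d N holomorphic_on cball 0 r"
            by (rule holomorphic_on_subset[OF holomorphic_on_cleared[OF holo]]) (use r in auto)
          show "cleared F d N holomorphic_on ball 0 r"
            by (rule holomorphic_on_subset[OF hol]) auto
          show "continuous_on (cball 0 r) (cleared F d N)"
            by (rule holomorphic_on_imp_continuous_on[OF hol])
          show "norm (cleared F d N x) \<le> \<tau>" if "norm (0 - x) = r" for x
            using le[OF _ \<tau>, of x] that r by simp
        qed
        then show ?thesis unfolding dk using r by (simp add: field_simps)
      qed
      then have ev: "eventually (\<lambda>r. norm (d k) * r ^ n \<le> \<tau>) (at_left 1)"
        by (intro eventually_at_leftI[of 0]) auto
      have "((\<lambda>r. norm (d k) * r ^ n) \<longlongrightarrow> norm (d k) * 1 ^ n) (at_left 1)"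
        by (intro tendsto_intros)
      from tendsto_upperbound[OF this ev] show ?thesis by simp
    qed
    have "norm (d k) \<le> 0 + e" if "e > 0" for e
    proof -
      have "(\<lambda>n. \<Sum>k. norm (d (k + n))) \<longlonglongrightarrow> 0" using d by (rule suminf_exist_split2)
      from eventually_conj[OF order_tendstoD(2)[OF this that] eventually_gt_at_top[of k]]
      obtain N where "(\<Sum>k. norm (d (k + N))) < e" "k < N" by (auto dest: eventually_happens)
      then show ?thesis using coeff[of N e] by simp
    qed
    then have "norm (d k) \<le> 0" by (rule field_le_epsilon)
    then show ?thesis by simp
  qed
  show "d = (\<lambda>_. 0)" using d0 by auto
  show "F z = 0" if "norm z < 1" for z
  proof -
    \<comment> \<open>With d = 0 and N = 0, \<open>cleared\<close> is \<open>F\<close> itself and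
      the tail is 0.\<close>
    have "norm (F z) \<le> 0 + e" if "e > 0" for e
      using le[of z 0 e] \<open>norm z < 1\<close> that by (simp add: cleared_def d0)
    then have "norm (F z) \<le> 0" by (rule field_le_epsilon)
    then show ?thesis by simp
  qed
qed

subsection \<open>The exceptional sets\<close>

text \<open>The hypothesis \<open>step\<close> carries an upper bound for \<open>Re g\<close> from
  \<open>A (Suc i)\<close> to \<open>A i\<close> at the cost \<open>p i\<close>. Starting at level m
  and descending to a fixed j costs less than 1/2 in total, whatever m is, whereas 1 - 4 h at a
  fixed point of \<open>A j\<close> tends to 1 as m grows.\<close>

lemma exceptional_set_eventually_empty:
  fixes A :: "nat \<Rightarrow> complex set"
  assumes A: "\<And>i. A i \<subseteq> ball 0 1" "\<And>i. A (Suc i) \<subseteq> A i"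
    and avoid: "AE t in lborel. eventually (\<lambda>m. A m \<inter> stolz_region 2 (cis t) = {}) sequentially"
    and step: "\<And>i g z. \<lbrakk>I \<le> i; g holomorphic_on ball 0 1; \<And>w. norm w < 1 \<Longrightarrow> Re (g w) \<le> 1;
      \<And>w. w \<in> A (Suc i) \<Longrightarrow> Re (g w) \<le> 0; z \<in> A i\<rbrakk> \<Longrightarrow> Re (g z) \<le> p i"
    and p: "\<And>i. I \<le> i \<Longrightarrow> 0 \<le> p i" "summable p"
  shows "\<exists>j. A j = {}"
proof -
  have "(\<lambda>n. suminf (\<lambda>k. p (k + n))) \<longlonglongrightarrow> 0" using p(2) by (rule suminf_exist_split2)
  from order_tendstoD(2)[OF this, of "1/2"]
  have "eventually (\<lambda>n. (\<Sum>k. p (k + n)) < 1/2 \<and> I \<le> n) sequentially"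
    by (intro eventually_conj eventually_ge_at_top) simp
  then obtain j where j: "(\<Sum>k. p (k + j)) < 1/2" "I \<le> j" by (auto dest: eventually_happens)
  have "z \<notin> A j" for z
  proof
    assume z: "z \<in> A j"
    have z1: "norm z < 1" using A(1)[of j] z by auto
    define X where "X m = {t \<in> {0..2*pi}. A m \<inter> stolz_region 2 (cis t) \<noteq> {}}" for m
    have X_iff: "t \<in> X m \<longleftrightarrow> t \<in> {0..2*pi} \<and> (\<exists>w\<in>A m. norm (w - cis t) < 2 * (1 - norm w))" for t m
    proof -
      have "A m \<subseteq> {w. norm w < 1}" using A(1)[of m] by auto
      then show ?thesis unfolding X_def stolz_region_def by blast
    qed
    have Xb: "X m \<in> sets borel" for m
    proof -
      have "X m = {0..2*pi} \<inter> (\<Union>w\<in>A m. {t. norm (w - cis t) < 2 * (1 - norm w)})"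
        using X_iff by blast
      moreover have "open (\<Union>w\<in>A m. {t. norm (w - cis t) < 2 * (1 - norm w)})"
        by (intro open_UN ballI open_Collect_less continuous_intros)
      ultimately show ?thesis by simp
    qed
    have X2: "X m \<subseteq> {0..2*pi}" for m by (auto simp: X_def)
    have X_lim: "(\<lambda>m. measure lborel (X m)) \<longlonglongrightarrow> 0"
      by (rule measure_tendsto_0_of_AE_eventually_notin[OF Xb X2], use avoid in eventually_elim)
         (auto simp: X_def elim!: eventually_mono)
    have main: "1 - 8 * measure lborel (X m) / (1 - norm z) \<le> 1/2" if m: "j \<le> m" for m
    proof -
      obtain g where g: "g holomorphic_on ball 0 1"
        "\<And>z. norm z < 1 \<Longrightarrow> 0 \<le> Re (g z)"
        "\<And>z. norm z < 1 \<Longrightarrow> Re (g z) \<le> 2 * measure lborel (X m) / (1 - norm z)"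
        "\<And>z. norm z < 1 \<Longrightarrow> {t \<in> {0..2*pi}. norm (z - cis t) < 2 * (1 - norm z)} \<subseteq> X m \<Longrightarrow> 1/4 \<le> Re (g z)"
        using schwarz_integral_exists[OF Xb[of m] X2[of m]] by blast
      \<comment> \<open>By definition \<open>X m\<close> contains the shadow of every point of
        \<open>A m\<close>; this makes 1 - 4 Re g at most 0 there and starts the descent.\<close>
      have top: "1/4 \<le> Re (g w)" if "w \<in> A m" for w
        by (rule g(4)) (use that A(1)[of m] X_iff in auto)
      have ind: "\<forall>w\<in>A (m - n). 1 - 4 * Re (g w) \<le> (\<Sum>i\<in>{m-n..<m}. p i)" if "n \<le> m - j" for n
        using that
      proof (induction n)
        case 0
        then show ?case using top by fastforce
      next
        case (Suc n)
        \<comment> \<open>Subtracting the cost \<sigma> accumulated so far restores the bound 0 on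
          the previous set; as \<sigma> \<ge> 0, the bound 1 on the disc survives.\<close>
        define \<sigma> where "\<sigma> = (\<Sum>i\<in>{m-n..<m}. p i)"
        have \<sigma>: "0 \<le> \<sigma>" unfolding \<sigma>_def using Suc.prems j(2) by (intro sum_nonneg p(1)) auto
        have S: "Suc (m - Suc n) = m - n" using Suc.prems by simp
        have "Re (1 - 4 * g w - of_real \<sigma>) \<le> p (m - Suc n)" if "w \<in> A (m - Suc n)" for w
        proof (rule step[where g = "\<lambda>w. 1 - 4 * g w - of_real \<sigma>", OF _ _ _ _ that])
          show "I \<le> m - Suc n" using Suc.prems j(2) m by simp
          show "(\<lambda>w. 1 - 4 * g w - of_real \<sigma>) holomorphic_on ball 0 1" by (intro holomorphic_intros g(1))
          show "Re (1 - 4 * g w - of_real \<sigma>) \<le> 1" if "norm w < 1" for w using g(2)[OF that] \<sigma> by simp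
          show "Re (1 - 4 * g w - of_real \<sigma>) \<le> 0" if "w \<in> A (Suc (m - Suc n))" for w
            using Suc.IH Suc.prems that unfolding S \<sigma>_def by simp
        qed
        moreover have "(\<Sum>i\<in>{m - Suc n..<m}. p i) = p (m - Suc n) + \<sigma>"
          unfolding \<sigma>_def using Suc.prems by (subst sum.atLeast_Suc_lessThan) (auto simp: S)
        ultimately show ?case by fastforce
      qed
      have "1 - 4 * Re (g z) \<le> (\<Sum>i\<in>{j..<m}. p i)" using ind[of "m - j"] m z by simp
      also have "\<dots> = (\<Sum>k<m - j. p (k + j))"
        using sum.shift_bounds_nat_ivl[of p 0 j "m - j"] m by (simp add: atLeast0LessThan)
      also have "\<dots> \<le> (\<Sum>k. p (k + j))"
        by (rule sum_le_suminf) (use p j in \<open>auto simp: summable_iff_shift\<close>)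
      finally show ?thesis using j(1) g(3)[OF z1] by simp
    qed
    have "(\<lambda>m. 1 - 8 * measure lborel (X m) / (1 - norm z)) \<longlonglongrightarrow> 1 - 8 * 0 / (1 - norm z)"
      by (intro tendsto_intros X_lim) (use z1 in auto)
    then have "1 - 8 * 0 / (1 - norm z) \<le> 1/2"
      by (rule tendsto_upperbound) (use main in \<open>auto simp: eventually_sequentially\<close>)
    then show False by simp
  qed
  then show ?thesis by blast
qed

subsection \<open>Estimates of the coefficients\<close>

text \<open>Since \<open>\<omega> t / t\<close> is increasing, so is \<open>\<omega>\<close>; hence
  1 / \<omega>(n) decreases and Cauchy condensation applies.\<close>

lemma summable_dyadic_ratio:
  fixes \<omega> :: "real \<Rightarrow> real"
  assumes pos: "\<forall>t>0. \<omega> t > 0"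
    and incr: "mono_on {0<..} (\<lambda>t. \<omega> t / t)"
    and sum: "summable (\<lambda>n. 1 / \<omega> (real (Suc n)))"
  shows "summable (\<lambda>i. 2 ^ i / \<omega> (2 ^ i))"
proof -
  define f where "f n = (if n = 0 then 0 else 1 / \<omega> (real n))" for n
  have mono: "\<omega> s \<le> \<omega> t" if "0 < s" "s \<le> t" for s t
  proof -
    have "\<omega> s / s \<le> \<omega> t / t" using incr that by (auto simp: mono_on_def)
    then have "\<omega> s * t \<le> \<omega> t * s" using that by (simp add: field_simps)
    moreover have "\<omega> s * s \<le> \<omega> s * t" using that pos by (intro mult_left_mono) (auto intro: less_imp_le)
    ultimately show ?thesis using that by (meson mult_right_le_imp_le order_trans)
  qed
  have "summable (\<lambda>n. f (Suc n))" using sum by (simp add: f_def)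
  then have "summable f" by (simp only: summable_Suc_iff)
  moreover have "f (Suc m) \<le> f m" if "0 < m" for m
  proof -
    have "\<omega> (real m) \<le> \<omega> (real (Suc m))" using that by (intro mono) auto
    then show ?thesis using that pos unfolding f_def by (auto intro!: divide_left_mono mult_pos_pos)
  qed
  moreover have "0 \<le> f n" for n using pos by (auto simp: f_def intro!: less_imp_le)
  ultimately have "summable (\<lambda>n. 2 ^ n * f (2 ^ n))" using condensation_test by blast
  then show ?thesis by (simp add: f_def)
qed

lemma dyadic_ratio_at_top:
  fixes \<omega> :: "real \<Rightarrow> real"
  assumes pos: "\<forall>t>0. \<omega> t > 0" and sum: "summable (\<lambda>i. 2 ^ i / \<omega> (2 ^ i))"
  shows "filterlim (\<lambda>i. \<omega> (2 ^ i) / 2 ^ i) at_top sequentially"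
proof -
  have "(\<lambda>i. 2 ^ i / \<omega> (2 ^ i)) \<longlonglongrightarrow> 0" using sum by (rule summable_LIMSEQ_zero)
  then have "filterlim (\<lambda>i. inverse (2 ^ i / \<omega> (2 ^ i))) at_top sequentially"
    by (rule filterlim_inverse_at_top) (use pos in \<open>auto intro!: always_eventually\<close>)
  then show ?thesis by simp
qed

text \<open>From x on, \<omega>(y) stays above the line of slope \<omega>(x)/x \<ge> 2 through the
  origin, so \<omega>(y) - 2 y is at least \<omega>(x) - 2 x. With y the logarithm of an index this
  leaves inverse-square decay to sum over.\<close>

lemma exp_minus_omega_le:
  fixes \<omega> :: "real \<Rightarrow> real"
  assumes incr: "mono_on {0<..} (\<lambda>t. \<omega> t / t)"
    and x: "0 < x" "2 * x \<le> \<omega> x" "x \<le> y"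
  shows "exp (- \<omega> y) \<le> exp (2 * x - \<omega> x) * exp (- 2 * y)"
proof -
  have "\<omega> x / x \<le> \<omega> y / y" using incr x by (auto simp: mono_on_def)
  then have 1: "(\<omega> x / x) * y \<le> \<omega> y" using x by (simp add: field_simps)
  have "0 \<le> (\<omega> x / x - 2) * (y - x)" using x by (intro mult_nonneg_nonneg) (auto simp: field_simps)
  moreover have "(\<omega> x / x - 2) * (y - x) = (\<omega> x / x) * y - \<omega> x - 2 * y + 2 * x"
    using x by (simp add: field_simps)
  ultimately have "- \<omega> y \<le> (2 * x - \<omega> x) + (- 2 * y)" using 1 by linarith
  then show ?thesis by (simp only: exp_add[symmetric] exp_le_cancel_iff)
qed

lemma coefficient_tail_le:
  fixes \<omega> :: "real \<Rightarrow> real" and d :: "nat \<Rightarrow> complex"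
  assumes incr: "mono_on {0<..} (\<lambda>t. \<omega> t / t)"
    and C: "0 \<le> C" "\<And>k. 1 \<le> k \<Longrightarrow> norm (d k) \<le> C * exp (- \<omega> (ln (real k + 1)))"
    and x: "1 \<le> x" "2 * x \<le> \<omega> x"
  shows "summable (\<lambda>k. norm (d (k + nat \<lfloor>exp x\<rfloor>)))"
    and "(\<Sum>k. norm (d (k + nat \<lfloor>exp x\<rfloor>))) \<le> C * exp (2 * x - \<omega> x) * (\<Sum>k. 1 / (real k + 1)\<^sup>2)"
proof -
  define N where "N = nat \<lfloor>exp x\<rfloor>"
  have e: "1 \<le> exp x" using x by simp
  \<comment> \<open>\<open>d k\<close> belongs to the exponent -(k + 1), so the tail from
    \<open>N\<close> on starts at index N + 1, which is at least exp x although \<open>N\<close> is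
    rounded down.\<close>
  have N: "1 \<le> N" "exp x \<le> real N + 1"
    using e unfolding N_def by (auto simp: le_nat_iff)
  have sq: "summable (\<lambda>k. 1 / (real k + 1)\<^sup>2)"
    using inverse_squares_sums by (simp add: sums_iff add.commute)
  have le: "norm (d (k + N)) \<le> C * exp (2 * x - \<omega> x) * (1 / (real k + 1)\<^sup>2)" for k
  proof -
    define y where "y = ln (real (k + N) + 1)"
    have "exp x \<le> real (k + N) + 1" using N by simp
    then have xy: "x \<le> y" unfolding y_def by (subst ln_ge_iff) auto
    have ey: "exp (- 2 * y) = 1 / (real (k + N) + 1)\<^sup>2"
    proof -
      have "exp (- 2 * y) = 1 / (exp y * exp y)"
        by (simp add: exp_minus exp_add[symmetric] inverse_eq_divide)
      moreover have "exp y = real (k + N) + 1" unfolding y_def by (rule exp_ln) linarith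
      ultimately show ?thesis by (simp add: power2_eq_square)
    qed
    have "norm (d (k + N)) \<le> C * exp (- \<omega> y)" unfolding y_def by (rule C(2)) (use N in simp)
    also have "\<dots> \<le> C * (exp (2 * x - \<omega> x) * exp (- 2 * y))"
      using C(1) exp_minus_omega_le[OF incr _ x(2) xy] x by (intro mult_left_mono) auto
    also have "exp (- 2 * y) \<le> 1 / (real k + 1)\<^sup>2"
      unfolding ey by (intro divide_left_mono power_mono mult_pos_pos) auto
    finally show ?thesis using C(1) by (simp add: mult_left_mono mult.assoc)
  qed
  have s2: "summable (\<lambda>k. C * exp (2 * x - \<omega> x) * (1 / (real k + 1)\<^sup>2))"
    by (intro summable_mult sq)
  have s1: "summable (\<lambda>k. norm (d (k + N)))"
    by (rule summable_comparison_test'[OF s2]) (use le in simp)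
  show "summable (\<lambda>k. norm (d (k + nat \<lfloor>exp x\<rfloor>)))" using s1 unfolding N_def .
  have "(\<Sum>k. norm (d (k + N))) \<le> (\<Sum>k. C * exp (2 * x - \<omega> x) * (1 / (real k + 1)\<^sup>2))"
    by (rule suminf_le[OF le s1 s2])
  also have "\<dots> = C * exp (2 * x - \<omega> x) * (\<Sum>k. 1 / (real k + 1)\<^sup>2)" by (rule suminf_mult[OF sq])
  finally show "(\<Sum>k. norm (d (k + nat \<lfloor>exp x\<rfloor>))) \<le> C * exp (2 * x - \<omega> x) * (\<Sum>k. 1 / (real k + 1)\<^sup>2)"
    unfolding N_def .
qed

text \<open>With \<delta> = exp (- x) \<le> 1/2 one has 1 - \<delta> \<ge> exp (- 2 \<delta>), and N
  \<delta> \<le> 1. So the factor z^N costs only a constant within distance exp (- x) of the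
  circle.\<close>

lemma power_floor_exp_ge:
  fixes r x :: real
  assumes x: "1 \<le> x" and r: "1 - exp (- x) \<le> r"
  shows "exp (- 2) \<le> r ^ nat \<lfloor>exp x\<rfloor>"
proof -
  define \<delta> where "\<delta> = exp (- x)"
  define N where "N = nat \<lfloor>exp x\<rfloor>"
  have "2 \<le> exp x" using exp_ge_add_one_self[of x] x by linarith
  then have \<delta>: "0 < \<delta>" "\<delta> \<le> 1/2" by (auto simp: \<delta>_def exp_minus field_simps)
  have N: "real N * \<delta> \<le> 1"
  proof -
    have "real N \<le> exp x" unfolding N_def by simp
    then show ?thesis by (simp add: \<delta>_def exp_minus field_simps)
  qed
  have "- 2 * \<delta> \<le> - \<delta> - 2 * \<delta>\<^sup>2" using \<delta> by (simp add: power2_eq_square)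
  also have "\<dots> \<le> ln (1 - \<delta>)" using \<delta> by (intro ln_one_minus_pos_lower_bound) auto
  finally have ln: "exp (- 2 * \<delta>) \<le> 1 - \<delta>" using \<delta> by (subst (asm) ln_ge_iff) auto
  have "exp (- 2) \<le> exp (real N * (- 2 * \<delta>))" using N by simp
  also have "\<dots> = exp (- 2 * \<delta>) ^ N" by (rule exp_of_nat_mult)
  also have "\<dots> \<le> r ^ N" using ln r by (intro power_mono) (auto simp: \<delta>_def)
  finally show ?thesis unfolding N_def .
qed

text \<open>The factor \<open>exp 2\<close> in the threshold offsets the loss from z^N; of the
  remaining sum plus 1, the polynomial can take away at most the sum.\<close>

lemma norm_cleared_ge:
  fixes d :: "nat \<Rightarrow> complex"
  assumes "summable (\<lambda>k. norm (d k))" "norm z \<le> 1" "exp (- 2) \<le> norm z ^ N"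
    "exp 2 * ((\<Sum>k. norm (d k)) + 1) \<le> norm (F z)"
  shows "1 \<le> norm (cleared F d N z)"
proof -
  have "exp (- 2) * (exp 2 * ((\<Sum>k. norm (d k)) + 1)) \<le> norm z ^ N * norm (F z)"
    using assms(3,4) suminf_nonneg[OF assms(1)] by (intro mult_mono) auto
  then have "(\<Sum>k. norm (d k)) + 1 \<le> norm (z ^ N * F z)"
    by (simp add: norm_mult norm_power mult.assoc[symmetric] exp_minus)
  then show ?thesis
    using norm_cleared_sum_le[OF assms(1,2), of N] norm_triangle_ineq2[of "z ^ N * F z" "\<Sum>k<N. d k * z ^ (N - 1 - k)"]
    unfolding cleared_def by linarith
qed

section \<open>Choice of constants, the exceptional sets and the conclusion\<close>

theorem theorem2:
  fixes F :: "complex \<Rightarrow> complex" and c :: "int \<Rightarrow> complex" and \<omega> :: "real \<Rightarrow> real"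
  assumes holo: "F holomorphic_on ball 0 1"
    and growth: "\<exists>M C. \<forall>z\<in>ball 0 1. norm (F z) \<le> C * (1 - norm z) powr (- M)"
    and omega_pos: "\<forall>t>0. \<omega> t > 0"
    and omega_incr: "mono_on {0<..} (\<lambda>t. \<omega> t / t)"
    and omega_sum: "summable (\<lambda>n. 1 / \<omega> (real (Suc n)))"
    and coeff: "\<exists>C. \<forall>n::int. n \<le> -2 \<longrightarrow> norm (c n) \<le> C * exp (- \<omega> (ln (real_of_int \<bar>n\<bar>)))"
    and boundary: "AE t in lborel. nontangential_limit F (cis t) (neg_series c (cis t))"
  shows "(\<forall>z\<in>ball 0 1. F z = 0) \<and> (\<forall>\<zeta>. norm \<zeta> = 1 \<longrightarrow> neg_series c \<zeta> = 0)"
proof -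
  obtain M0 C1' where g0: "\<forall>z\<in>ball 0 1. norm (F z) \<le> C1' * (1 - norm z) powr (- M0)"
    using growth by blast
  define M where "M = max M0 0"
  define C1 where "C1 = max C1' 0"
  have M: "0 \<le> M" and C1: "0 \<le> C1" by (auto simp: M_def C1_def)
  have Fle: "norm (F z) \<le> C1 * exp (M * x)" if z: "norm z \<le> 1 - exp (- x)" for z x
  proof -
    have z1: "norm z < 1" using z exp_gt_zero[of "- x"] by linarith
    have "norm (F z) \<le> C1' * (1 - norm z) powr (- M0)" using g0 z1 by simp
    also have "\<dots> \<le> C1 * (1 - norm z) powr (- M)"
      using z1 by (intro mult_mono powr_mono') (auto simp: C1_def M_def)
    also have "\<dots> \<le> C1 * exp (- x) powr (- M)"
      using z M C1 by (intro mult_left_mono powr_mono2') auto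
    also have "exp (- x) powr (- M) = exp (M * x)" by (simp add: powr_def)
    finally show ?thesis .
  qed

  define d where "d k = c (- (int k + 1))" for k
  have ns: "neg_series c \<zeta> = (\<Sum>k. d k * \<zeta> powi (- (int k + 1)))" for \<zeta>
    by (simp only: neg_series_def d_def)
  note lim = boundary[unfolded ns]
  obtain C' where C': "\<And>n::int. n \<le> -2 \<Longrightarrow> norm (c n) \<le> C' * exp (- \<omega> (ln (real_of_int \<bar>n\<bar>)))"
    using coeff by blast
  define C where "C = max C' 0"
  have C: "0 \<le> C" by (simp add: C_def)
  have dC: "norm (d k) \<le> C * exp (- \<omega> (ln (real k + 1)))" if "1 \<le> k" for k
  proof -
    have "norm (d k) \<le> C' * exp (- \<omega> (ln (real_of_int \<bar>- (int k + 1)\<bar>)))"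
      unfolding d_def by (rule C') (use that in simp)
    also have "real_of_int \<bar>- (int k + 1)\<bar> = real k + 1" by simp
    also have "C' * exp (- \<omega> (ln (real k + 1))) \<le> C * exp (- \<omega> (ln (real k + 1)))"
      by (intro mult_right_mono) (auto simp: C_def)
    finally show ?thesis .
  qed

  have sum2: "summable (\<lambda>i. 2 ^ i / \<omega> (2 ^ i))"
    by (rule summable_dyadic_ratio[OF omega_pos omega_incr omega_sum])
  define P where "P = (\<Sum>k. 1 / (real k + 1)\<^sup>2)"
  have P: "0 \<le> P" unfolding P_def
    using inverse_squares_sums by (intro suminf_nonneg) (auto simp: sums_iff add.commute)
  define N where "N i = nat \<lfloor>exp (2 ^ i :: real)\<rfloor>" for i :: nat
  \<comment> \<open>\<open>exp L\<close> absorbs the constant C P. Once \<omega>(2^i) \<ge> (4 + 2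
    L) 2^i, half of \<omega>(2^i) pays for both L and 2 * 2^i, leaving exp (- \<omega>(2^i)/2) for
    the tail.\<close>
  define L where "L = ln (C * P + 1)"
  have L: "0 \<le> L" "C * P \<le> exp L" unfolding L_def using C P by (auto simp: add_nonneg_pos)
  have "eventually (\<lambda>i. 4 + 2 * L \<le> \<omega> (2 ^ i) / 2 ^ i) sequentially"
    using dyadic_ratio_at_top[OF omega_pos sum2] by (simp add: filterlim_at_top)
  then obtain I where I: "\<And>i. I \<le> i \<Longrightarrow> 4 + 2 * L \<le> \<omega> (2 ^ i) / 2 ^ i"
    by (auto simp: eventually_sequentially)
  have w1: "(4 + 2 * L) * 2 ^ i \<le> \<omega> (2 ^ i)" if "I \<le> i" for i
    using I[OF that] by (simp add: field_simps)
  have w2: "2 * 2 ^ i \<le> \<omega> (2 ^ i)" if "I \<le> i" for i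
  proof -
    have "2 * 2 ^ i \<le> (4 + 2 * L) * (2 ^ i :: real)" using L by (intro mult_right_mono) auto
    then show ?thesis using w1[OF that] by linarith
  qed
  have tail: "(\<Sum>k. norm (d (k + N i))) \<le> exp (- (\<omega> (2 ^ i) / 2))" if i: "I \<le> i" for i
  proof -
    have "(\<Sum>k. norm (d (k + N i))) \<le> C * exp (2 * 2 ^ i - \<omega> (2 ^ i)) * P"
      unfolding N_def P_def by (rule coefficient_tail_le(2)[where \<omega> = \<omega>, OF omega_incr C dC _ w2[OF i]]) auto
    also have "\<dots> = (C * P) * exp (2 * 2 ^ i - \<omega> (2 ^ i))" by simp
    also have "\<dots> \<le> exp L * exp (2 * 2 ^ i - \<omega> (2 ^ i))" using L by (intro mult_right_mono) auto
    also have "\<dots> = exp (L + 2 * 2 ^ i - \<omega> (2 ^ i))" by (simp add: exp_add[symmetric])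
    also have "\<dots> \<le> exp (- (\<omega> (2 ^ i) / 2))"
    proof -
      have "L * 1 \<le> L * 2 ^ i" using L by (intro mult_left_mono) auto
      then show ?thesis using w1[OF i] by (simp add: algebra_simps)
    qed
    finally show ?thesis .
  qed
  have sd: "summable (\<lambda>k. norm (d k))"
    using coefficient_tail_le(1)[where \<omega> = \<omega> and x = "2 ^ I", OF omega_incr C dC _ w2[of I]]
    by (simp add: summable_iff_shift[of "\<lambda>k. norm (d k)"])
  define S where "S = (\<Sum>k. norm (d k))"
  have S: "0 \<le> S" unfolding S_def by (rule suminf_nonneg[OF sd]) simp
  \<comment> \<open>This is the threshold of \<open>norm_cleared_ge\<close>; it also exceeds
    \<open>S\<close>, which bounds the boundary values.\<close>
  define C0 where "C0 = exp 2 * (S + 1)"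
  have C0: "S < C0"
  proof -
    have "1 * (S + 1) \<le> C0" unfolding C0_def using S by (intro mult_right_mono) auto
    then show ?thesis by simp
  qed
  define A where "A i = {z \<in> ball 0 1. 1 - exp (- (2 ^ i)) \<le> norm z \<and> C0 \<le> norm (F z)}" for i :: nat
  have contF: "continuous_on (ball 0 1) F" by (rule holomorphic_on_imp_continuous_on[OF holo])
  have openA: "open (ball 0 1 - A i)" for i
  proof -
    have "ball 0 1 - A i = (ball 0 1 \<inter> {z. norm z < 1 - exp (- (2 ^ i))}) \<union> (ball 0 1 \<inter> (\<lambda>z. norm (F z)) -` {..<C0})"
      by (auto simp: A_def)
    moreover have "open (ball 0 1 \<inter> {z::complex. norm z < 1 - exp (- (2 ^ i))})"
      by (intro open_Int open_ball open_Collect_less continuous_intros)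
    moreover have "open (ball 0 1 \<inter> (\<lambda>z. norm (F z)) -` {..<C0})"
      by (rule continuous_open_preimage) (auto intro!: continuous_intros contF)
    ultimately show ?thesis by (simp only: open_Un)
  qed
  define Q where "Q = C1 + C0 + S + 2"
  have Q: "2 \<le> Q" using C1 C0 S by (simp add: Q_def)
  \<comment> \<open>The value comes from solving \<omega>(2^i)/2 * Re g \<le> ln Q + 2 M 2^i for Re
    g.\<close>
  define \<Gamma> where "\<Gamma> = 2 * (ln Q + 2 * M)"
  have \<Gamma>: "0 \<le> \<Gamma>" unfolding \<Gamma>_def using Q M by simp

  have "\<exists>j. A j = {}"
  proof (rule exceptional_set_eventually_empty[where p = "\<lambda>i. \<Gamma> * (2 ^ i / \<omega> (2 ^ i))" and I = I])
    show "A i \<subseteq> ball 0 1" for i by (auto simp: A_def)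
    show "A (Suc i) \<subseteq> A i" for i
    proof -
      have "1 - exp (- (2 ^ i)) \<le> 1 - exp (- (2 ^ Suc i) :: real)" by simp
      from order_trans[OF this] show ?thesis unfolding A_def by blast
    qed
    show "AE t in lborel. \<forall>\<^sub>F m in sequentially. A m \<inter> stolz_region 2 (cis t) = {}"
      using lim
    proof eventually_elim
      case (elim t)
      define l where "l = (\<Sum>k. d k * cis t powi (- (int k + 1)))"
      have "norm l \<le> S"
        using norm_cleared_boundary_le[OF sd, of "cis t" 0] by (simp add: cleared_def l_def S_def)
      then have "norm l < C0" using C0 by simp
      moreover have "((\<lambda>z. norm (F z)) \<longlongrightarrow> norm l) (at (cis t) within stolz_region 2 (cis t))"
        using elim unfolding nontangential_limit_def l_def by (intro tendsto_norm) auto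
      ultimately have "\<forall>\<^sub>F z in at (cis t) within stolz_region 2 (cis t). norm (F z) < C0"
        by (intro order_tendstoD(2))
      then obtain e where e: "e > 0" "\<And>z. z \<in> stolz_region 2 (cis t) \<Longrightarrow> z \<noteq> cis t \<Longrightarrow> dist z (cis t) < e \<Longrightarrow> norm (F z) < C0"
        by (auto simp: eventually_at)
      \<comment> \<open>A point of \<open>A m\<close> in the Stolz region of aperture 2 is within 2
        exp (- 2^m) of the boundary point, where eventually |F| < C0.\<close>
      have "(\<lambda>m::nat. 2 * exp (- (2 ^ m)) :: real) \<longlonglongrightarrow> 0" by real_asymp
      from order_tendstoD(2)[OF this e(1)] show ?case
      proof eventually_elim
        case (elim m)
        show ?case
        proof (rule ccontr)
          assume "A m \<inter> stolz_region 2 (cis t) \<noteq> {}"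
          then obtain z where z: "z \<in> A m" "z \<in> stolz_region 2 (cis t)" by blast
          have "dist z (cis t) < e"
            using z elim by (auto simp: A_def stolz_region_def dist_norm)
          moreover have "z \<noteq> cis t" using z by (auto simp: A_def)
          ultimately show False using e(2)[OF z(2)] z(1) by (auto simp: A_def)
        qed
      qed
    qed
    show "0 \<le> \<Gamma> * (2 ^ i / \<omega> (2 ^ i))" for i
      using \<Gamma> omega_pos by (intro mult_nonneg_nonneg divide_nonneg_nonneg) (auto intro: less_imp_le)
    show "summable (\<lambda>i. \<Gamma> * (2 ^ i / \<omega> (2 ^ i)))" by (rule summable_mult[OF sum2])
    fix i g z
    assume i: "I \<le> i" and g: "g holomorphic_on ball 0 1" "\<And>w. norm w < 1 \<Longrightarrow> Re (g w) \<le> 1"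
      "\<And>w. w \<in> A (Suc i) \<Longrightarrow> Re (g w) \<le> 0" and z: "z \<in> A i"
    have wp: "0 < \<omega> (2 ^ i)" using omega_pos by simp
    show "Re (g z) \<le> \<Gamma> * (2 ^ i / \<omega> (2 ^ i))"
    proof (cases "z \<in> A (Suc i)")
      case True
      have "0 \<le> \<Gamma> * (2 ^ i / \<omega> (2 ^ i))" using \<Gamma> wp by simp
      then show ?thesis using g(3)[OF True] by linarith
    next
      case False
      define E where "E = Q * exp (2 * M * 2 ^ i)"
      have e1: "1 \<le> exp (2 * M * 2 ^ i)" using M by simp
      have QE: "a + b * exp (2 * M * 2 ^ i) \<le> E" if "0 \<le> a" "a + b \<le> Q" for a b
      proof -
        have "a * 1 \<le> a * exp (2 * M * 2 ^ i)" using that e1 by (intro mult_left_mono) auto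
        then have "a + b * exp (2 * M * 2 ^ i) \<le> (a + b) * exp (2 * M * 2 ^ i)" by (simp add: algebra_simps)
        also have "\<dots> \<le> E" unfolding E_def using that by (intro mult_right_mono) auto
        finally show ?thesis .
      qed
      have "norm (cleared F d (N i) z) * exp (\<omega> (2 ^ i) / 2 * Re (g z)) \<le> E"
      proof (rule norm_cleared_exp_le[OF holo sd lim _ openA[of "Suc i"] _ _ _ tail[OF i] g])
        show "A (Suc i) \<subseteq> ball 0 1" by (auto simp: A_def)
        show "2 \<le> E" using QE[of 2 0] Q by simp
        show "0 \<le> \<omega> (2 ^ i) / 2" using wp by simp
        show "z \<in> ball 0 1 - A (Suc i)" using False z by (auto simp: A_def)
        fix w assume w: "w \<in> ball 0 1 - A (Suc i)"
        show "norm (F w) + (\<Sum>k. norm (d k)) \<le> E"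
        \<comment> \<open>Away from the circle the growth of \<open>F\<close> gives exp (M 2^(i+1))
          = exp (2 M 2^i); close to it, being outside \<open>A (Suc i)\<close> forces |F| <
          C0.\<close>
        proof (cases "norm w \<le> 1 - exp (- (2 ^ Suc i))")
          case True
          have "norm (F w) \<le> C1 * exp (M * 2 ^ Suc i)" by (rule Fle[OF True])
          also have "M * 2 ^ Suc i = 2 * M * 2 ^ i" by simp
          finally show ?thesis using QE[of S C1] S C0 by (simp add: Q_def S_def)
        next
          case False
          then have "norm (F w) < C0" using w by (auto simp: A_def)
          then show ?thesis using QE[of "S + C0" 0] S C0 C1 by (simp add: Q_def S_def)
        qed
      qed
      moreover have "1 \<le> norm (cleared F d (N i) z)"
        by (rule norm_cleared_ge[OF sd])
           (use z power_floor_exp_ge[of "2 ^ i" "norm z"] in \<open>auto simp: A_def N_def C0_def S_def\<close>)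
      ultimately have "1 * exp (\<omega> (2 ^ i) / 2 * Re (g z)) \<le> E"
        by (elim order_trans[rotated]) (intro mult_right_mono, auto)
      also have "E = exp (ln Q + 2 * M * 2 ^ i)" using Q by (simp add: E_def exp_add)
      finally have "\<omega> (2 ^ i) / 2 * Re (g z) \<le> ln Q + 2 * M * 2 ^ i"
        by (simp only: mult_1_left exp_le_cancel_iff)
      also have "\<dots> \<le> (ln Q + 2 * M) * 2 ^ i"
      proof -
        have "ln Q * 1 \<le> ln Q * 2 ^ i" using Q by (intro mult_left_mono) auto
        then show ?thesis by (simp add: algebra_simps)
      qed
      finally show ?thesis using wp by (simp add: \<Gamma>_def field_simps)
    qed
  qed
  then obtain j where j: "A j = {}" by blast
  \<comment> \<open>Growth bounds \<open>F\<close> away from the circle, and emptiness of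
    \<open>A j\<close> bounds it near the circle.\<close>
  have bdd: "norm (F z) \<le> C1 * exp (M * 2 ^ j) + C0" if "norm z < 1" for z
  proof (cases "norm z \<le> 1 - exp (- (2 ^ j))")
    case True
    then show ?thesis using Fle[OF True] C0 S by simp
  next
    case False
    then have "norm (F z) < C0" using j that unfolding A_def by force
    then show ?thesis using C1 by (simp add: add_increasing)
  qed
  have d0: "d = (\<lambda>_. 0)" and F0: "\<And>z. norm z < 1 \<Longrightarrow> F z = 0"
    using bounded_imp_zero[OF holo bdd sd lim] by auto
  show ?thesis using F0 by (simp add: ns d0)
qed

end
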